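(* Let $G=(V,E)$ be a finite graph with at least one edge, let $p\in(0,1)$ and let $q\ge 1$ be a natural number. Let $P_{\rm SW}$ and $P_{\rm SB}$ be the transition matrices of the Swendsen-Wang dynamics and of the (lazy) single-bond dynamics for the random-cluster model on $G$ with parameters $p$ and $q$. Then $$\lambda(P_{\rm SW})\;\ge\;\lambda(P_{\rm SB}),$$ where $\lambda(\cdot)$ denotes the spectral gap.
   Context: The random-cluster model on $G$ with parameters $p,q$ has state space $\Omega_{\rm RC}=\{A: A\subseteq E\}$ and probability measure $\mu(A)=\frac1Z\left(\frac{p}{1-p}\right)^{|A|}q^{c(A)}$, where $c(A)$ is the number of connected components of $(V,A)$ (isolated vertices count as components) and $Z$ is the normalizing constant. Let $\Omega_{\rm P}=\{1,\dots,q\}^V$. For $A\subseteq E$ let $\Omega(A)=\{\sigma\in\Omega_{\rm P}:\sigma(u)=\sigma(v)\text{ for all }\{u,v\}\in A\}$, and for $\sigma\in\Omega_{\rm P}$ let $E(\sigma)=\{\{u,v\}\in E:\sigma(u)=\sigma(v)\}$. Write $\mathbf 1(\cdot)$ for the indicator. Swendsen-Wang dynamics (on $\Omega_{\rm RC}$): for $A,B\subseteq E$, $$P_{\rm SW}(A,B)=q^{-c(A)}\left(\frac{p}{1-p}\right)^{|B|}\sum_{\sigma\in\Omega_{\rm P}}(1-p)^{|E(\sigma)|}\,\mathbf 1\bigl(\sigma\in\Omega(A\cup B)\bigr).$$ That is: given $A$, color each connected component of $(V,A)$ independently and uniformly with a color in $\{1,\dots,q\}$, obtaining $\sigma$; then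 keep each edge of $E(\sigma)$ independently with probability $p$ to obtain $B$. Single-bond dynamics (on $\Omega_{\rm RC}$): $P_{\rm SB}(A,B)=\frac12\mathbf 1(A=B)+\frac1{2|E|}\sum_{e\in E}P_e(A,B)$, where for $e=\{e_1,e_2\}$, $P_e(A,B)=0$ unless the symmetric difference of $A$ and $B$ is contained in $\{e\}$, in which case $P_e(A,B)=p^{|B\cap\{e\}|}(1-p)^{1-|B\cap\{e\}|}$ if $e_1,e_2$ are connected in $(V,A)$, and $P_e(A,B)=\left(\frac pq\right)^{|B\cap\{e\}|}\left(1-\frac pq\right)^{1-|B\cap\{e\}|}$ if they are not connected in $(V,A)$. Both chains are ergodic and reversible with respect to $\mu$. The spectral gap of an ergodic reversible transition matrix $P$ is $\lambda(P)=1-\max\{|\xi|:\xi\text{ is an eigenvalue of }P,\ \xi\ne1\}$. *)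

theory Defs
  imports
    Complex_Main
    "HOL-Library.FuncSet"
    "HOL-Library.Countable_Set"
    "Jordan_Normal_Form.Char_Poly"
begin

definition finite_graph :: "'v set \<Rightarrow> 'v set set \<Rightarrow> bool" where
  "finite_graph V E \<longleftrightarrow>
     finite V \<and> (\<forall>e\<in>E. \<exists>u v. u \<in> V \<and> v \<in> V \<and> u \<noteq> v \<and> e = {u, v})"

definition conn :: "'v set set \<Rightarrow> ('v \<times> 'v) set" where
  "conn A = {(u, v). {u, v} \<in> A}\<^sup>*"

text \<open>When the edges in \<open>A\<close> join vertices of \<open>V\<close>, every class of \<open>conn A\<close> that meets
  \<open>V\<close> lies inside \<open>V\<close>, so the quotient is the set of connected components of \<open>(V, A)\<close>,
  with each isolated vertex as a singleton class.\<close>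

definition ncomp :: "'v set \<Rightarrow> 'v set set \<Rightarrow> nat" where
  "ncomp V A = card (V // conn A)"

definition colorings :: "'v set \<Rightarrow> nat \<Rightarrow> ('v \<Rightarrow> nat) set" where
  "colorings V q = V \<rightarrow>\<^sub>E {1..q}"

definition compatible_colorings :: "'v set \<Rightarrow> nat \<Rightarrow> 'v set set \<Rightarrow> ('v \<Rightarrow> nat) set" where
  "compatible_colorings V q A =
     {\<sigma> \<in> colorings V q. \<forall>u v. {u, v} \<in> A \<longrightarrow> \<sigma> u = \<sigma> v}"

definition mono_edges :: "'v set set \<Rightarrow> ('v \<Rightarrow> nat) \<Rightarrow> 'v set set" where
  "mono_edges E \<sigma> = {{u, v} | u v. {u, v} \<in> E \<and> \<sigma> u = \<sigma> v}"

definition P_SW :: "'v set \<Rightarrow> 'v set set \<Rightarrow> real \<Rightarrow> nat \<Rightarrow> 'v set set \<Rightarrow> 'v set set \<Rightarrow> real" where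
  "P_SW V E p q A B =
     inverse (real q ^ ncomp V A) * (p / (1 - p)) ^ card B *
     (\<Sum>\<sigma>\<in>colorings V q. (1 - p) ^ card (mono_edges E \<sigma>) *
        of_bool (\<sigma> \<in> compatible_colorings V q (A \<union> B)))"

definition P_edge :: "real \<Rightarrow> nat \<Rightarrow> 'v set \<Rightarrow> 'v set set \<Rightarrow> 'v set set \<Rightarrow> real" where
  "P_edge p q e A B =
     (if sym_diff A B \<subseteq> {e} then
        if \<exists>u v. e = {u, v} \<and> (u, v) \<in> conn A
        then p ^ card (B \<inter> {e}) * (1 - p) ^ (1 - card (B \<inter> {e}))
        else (p / real q) ^ card (B \<inter> {e}) * (1 - p / real q) ^ (1 - card (B \<inter> {e}))
      else 0)"

definition P_SB :: "'v set set \<Rightarrow> real \<Rightarrow> nat \<Rightarrow> 'v set set \<Rightarrow> 'v set set \<Rightarrow> real" where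
  "P_SB E p q A B =
     1 / 2 * of_bool (A = B) + 1 / (2 * real (card E)) * (\<Sum>e\<in>E. P_edge p q e A B)"

text \<open>The enumeration \<open>from_nat_into S\<close> of the finite state space \<open>S\<close> is an arbitrary
  bijection from \<open>{..<card S}\<close> to \<open>S\<close>; another choice conjugates the matrix by a
  permutation and leaves its eigenvalues unchanged. The matrix is taken over the complex
  numbers so that no eigenvalue is lost.\<close>

definition transition_mat :: "'s set \<Rightarrow> ('s \<Rightarrow> 's \<Rightarrow> real) \<Rightarrow> complex mat" where
  "transition_mat S P =
     mat (card S) (card S)
       (\<lambda>(i, j). complex_of_real (P (from_nat_into S i) (from_nat_into S j)))"

text \<open>\<open>Max\<close> is unspecified on the empty set: the definition is meant for ergodic reversible
  kernels with at least two states, which are diagonalizable with \<open>1\<close> a simple eigenvalue and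
  hence have an eigenvalue other than \<open>1\<close>.\<close>

definition spectral_gap :: "'s set \<Rightarrow> ('s \<Rightarrow> 's \<Rightarrow> real) \<Rightarrow> real" where
  "spectral_gap S P = 1 - Max {cmod \<xi> | \<xi>. eigenvalue (transition_mat S P) \<xi> \<and> \<xi> \<noteq> 1}"

end

theory Submission
  imports Defs "HOL-Analysis.Function_Topology" "HOL-Analysis.Convex"
begin

text \<open>
  Let \<open>\<mu>\<close> be the random-cluster weight. The theorem follows from an inequality between the quadratic
  forms of the two kernels in \<open>L\<^sup>2(\<mu>)\<close>: \<open>0 \<le> \<langle>f, P_SW f\<rangle> \<le> \<langle>f, P_SB f\<rangle>\<close> for every real \<open>f\<close>.

  To see the inequality, expand \<open>q\<close> to the power \<open>c(A)\<close> as the number of colorings compatible with \<open>A\<close>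
  and sum over the coloring \<open>\<sigma>\<close> first (the Edwards--Sokal coupling). Given \<open>\<sigma>\<close>, the set \<open>A\<close> is a
  Bernoulli(\<open>p\<close>) percolation on the monochromatic edges \<open>E(\<sigma>)\<close>, with expectation \<open>\<bbbE>\<close>, say. The term
  of \<open>\<sigma>\<close> in \<open>\<langle>f, P_SW f\<rangle>\<close> is proportional to \<open>(\<bbbE> f)\<^sup>2\<close>, because all edges are resampled. The
  term in the form of a single edge \<open>e\<close> is proportional, with the same factor, to \<open>\<bbbE> (f T f)\<close>, where
  \<open>T\<close> averages over the state of \<open>e\<close> if \<open>e \<in> E(\<sigma>)\<close> and is the identity otherwise
  (\<open>rc_weight_P_edge\<close>). As \<open>T\<close> is an orthogonal projection that preserves the mean,
  \<open>\<bbbE> (f T f) = \<bbbE> ((T f)\<^sup>2) \<ge> (\<bbbE> f)\<^sup>2\<close> (\<open>mean_square_le_bond_update\<close>). Averaging over \<open>e\<close>, and using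
  \<open>\<bbbE> (f\<^sup>2) \<ge> (\<bbbE> f)\<^sup>2\<close> for the lazy half of the single-bond chain, gives
  \<open>form_P_SW_le_form_P_SB\<close>.

  The passage from forms to gaps (\<open>spectral_gap_mono_form\<close>) is variational. The Rayleigh quotient of
  \<open>P_SB\<close> on the mean-zero functions attains its maximum \<open>\<rho>\<close> at an eigenfunction, and \<open>\<rho> < 1\<close> by the
  maximum principle. An eigenvector of \<open>P_SW\<close> with eigenvalue \<open>\<xi> \<noteq> 1\<close> has mean zero; \<open>\<xi>\<close> is real by
  self-adjointness and lies between \<open>0\<close> and \<open>\<rho>\<close> by the inequality of the forms.
\<close>

section \<open>Reversible kernels on a finite set\<close>

text \<open>The inner product of \<open>L\<^sup>2(w)\<close>. Values outside \<open>S\<close> are irrelevant.\<close>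

definition weighted_inner :: "'s set \<Rightarrow> ('s \<Rightarrow> real) \<Rightarrow> ('s \<Rightarrow> real) \<Rightarrow> ('s \<Rightarrow> real) \<Rightarrow> real" where
  "weighted_inner S w f g = (\<Sum>x\<in>S. w x * f x * g x)"

text \<open>The action \<open>f \<mapsto> K f\<close> of a kernel on functions.\<close>

definition kernel_op :: "'s set \<Rightarrow> ('s \<Rightarrow> 's \<Rightarrow> real) \<Rightarrow> ('s \<Rightarrow> real) \<Rightarrow> 's \<Rightarrow> real" where
  "kernel_op S K f x = (\<Sum>y\<in>S. K x y * f y)"

text \<open>Irreducibility of a nonnegative kernel: no proper nonempty set of states is closed under the
  transitions of positive weight.\<close>

definition irreducible_kernel :: "'s set \<Rightarrow> ('s \<Rightarrow> 's \<Rightarrow> real) \<Rightarrow> bool" where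
  "irreducible_kernel S K \<longleftrightarrow>
     (\<forall>T\<subseteq>S. T \<noteq> {} \<longrightarrow> (\<forall>x\<in>T. \<forall>y\<in>S. 0 < K x y \<longrightarrow> y \<in> T) \<longrightarrow> T = S)"

text \<open>A kernel with row sums one, in detailed balance with the weights \<open>w\<close>. The weights need not be
  normalised, and nonnegativity of \<open>K\<close> is not part of the notion: only the maximum principle needs
  it.\<close>

locale reversible_kernel =
  fixes S :: "'s set" and w :: "'s \<Rightarrow> real" and K :: "'s \<Rightarrow> 's \<Rightarrow> real"
  assumes finite_states: "finite S"
    and weight_pos: "x \<in> S \<Longrightarrow> 0 < w x"
    and row_sum: "x \<in> S \<Longrightarrow> (\<Sum>y\<in>S. K x y) = 1"
    and detailed_balance: "x \<in> S \<Longrightarrow> y \<in> S \<Longrightarrow> w x * K x y = w y * K y x"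
begin

abbreviation ip where "ip \<equiv> weighted_inner S w"
abbreviation op where "op \<equiv> kernel_op S K"

lemma ip_commute: "ip f g = ip g f"
  by (simp add: weighted_inner_def mult.commute mult.left_commute)

lemma ip_lincomb_left: "ip (\<lambda>x. a * f x + b * g x) h = a * ip f h + b * ip g h"
  by (simp add: weighted_inner_def sum_distrib_left sum.distrib[symmetric] algebra_simps)

lemma op_lincomb: "op (\<lambda>x. a * f x + b * g x) = (\<lambda>x. a * op f x + b * op g x)"
  by (rule ext) (simp add: kernel_op_def sum_distrib_left sum.distrib[symmetric] algebra_simps)

lemma ip_nonneg: "0 \<le> ip f f"
  unfolding weighted_inner_def
  by (rule sum_nonneg) (simp add: weight_pos less_imp_le mult.assoc)

lemma ip_pos_iff: "0 < ip f f \<longleftrightarrow> (\<exists>x\<in>S. f x \<noteq> 0)"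
proof
  assume "0 < ip f f"
  then show "\<exists>x\<in>S. f x \<noteq> 0"
    unfolding weighted_inner_def by (metis (no_types, lifting) mult_zero_right order_less_irrefl sum.neutral)
next
  assume "\<exists>x\<in>S. f x \<noteq> 0"
  then obtain x where x: "x \<in> S" "f x \<noteq> 0" by blast
  show "0 < ip f f" unfolding weighted_inner_def
  proof (rule sum_pos2[OF finite_states x(1)])
    show "0 < w x * f x * f x"
      using x weight_pos[of x] by (auto simp: mult.assoc zero_less_mult_iff linorder_neq_iff)
    show "0 \<le> w y * f y * f y" if "y \<in> S" for y
      using weight_pos[OF that] by (simp add: mult.assoc)
  qed
qed

lemma op_self_adjoint: "ip (op f) g = ip f (op g)"
proof -
  have "ip (op f) g = (\<Sum>x\<in>S. \<Sum>y\<in>S. (w x * K x y) * f y * g x)"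
    by (simp add: weighted_inner_def kernel_op_def sum_distrib_left sum_distrib_right mult.assoc)
  also have "\<dots> = (\<Sum>x\<in>S. \<Sum>y\<in>S. (w y * K y x) * f y * g x)"
    using detailed_balance by (intro sum.cong refl) (metis (no_types))
  also have "\<dots> = (\<Sum>y\<in>S. \<Sum>x\<in>S. (w y * K y x) * f y * g x)"
    by (rule sum.swap)
  also have "\<dots> = ip f (op g)"
    by (simp add: weighted_inner_def kernel_op_def sum_distrib_left mult_ac)
  finally show ?thesis .
qed

lemma op_preserves_mean: "ip (op f) (\<lambda>_. 1) = ip f (\<lambda>_. 1)"
proof -
  have "ip f (op (\<lambda>_. 1)) = ip f (\<lambda>_. 1)"
    by (simp add: weighted_inner_def kernel_op_def row_sum)
  then show ?thesis by (simp add: op_self_adjoint)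
qed

text \<open>The mean-zero functions of norm one, extended by zero outside \<open>S\<close>, form a closed subset of a
  product of compact intervals, so the continuous function \<open>f \<mapsto> \<langle>f, K f\<rangle>\<close> attains its supremum
  there.\<close>

lemma rayleigh_max_attained:
  assumes "2 \<le> card S"
  shows "\<exists>g. ip g (\<lambda>_. 1) = 0 \<and> ip g g = 1 \<and>
    (\<forall>f. ip f (\<lambda>_. 1) = 0 \<longrightarrow> ip f (op f) \<le> ip g (op g) * ip f f)"
proof -
  define H where "H = {f. (\<forall>x. x \<notin> S \<longrightarrow> f x = 0) \<and> ip f (\<lambda>_. 1) = 0 \<and> ip f f = 1}"
  define R where "R x = (if x \<in> S then {- (1 + 1 / w x) .. 1 + 1 / w x} else {0::real})" for x
  have "compactin (product_topology (\<lambda>_. euclidean) UNIV) (PiE UNIV R)"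
    unfolding compactin_PiE by (intro disjI2) (auto simp: R_def)
  then have comp: "compact (PiE UNIV R)"
    unfolding euclidean_product_topology by (simp only: compactin_euclidean_iff)
  have coord: "continuous_on T (\<lambda>f::'s \<Rightarrow> real. f x)" for T x
    by (rule continuous_on_subset[OF continuous_on_product_coordinates]) simp
  have cont_mean: "continuous_on T (\<lambda>f. ip f (\<lambda>_. 1))" for T
    unfolding weighted_inner_def by (intro continuous_intros coord)
  have cont_norm: "continuous_on T (\<lambda>f. ip f f)" for T
    unfolding weighted_inner_def by (intro continuous_intros coord)
  have cont_form: "continuous_on T (\<lambda>f. ip f (op f))" for T
    unfolding weighted_inner_def kernel_op_def by (intro continuous_intros coord)
  have "closed H"
    unfolding H_def
    by (intro closed_Collect_conj closed_Collect_all closed_Collect_imp closed_Collect_eq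
        open_Collect_const continuous_on_const cont_mean cont_norm coord)
  have bound: "f x \<in> R x" if "f \<in> H" for f x
  proof (cases "x \<in> S")
    case True
    have "w x * f x * f x \<le> ip f f" unfolding weighted_inner_def
      by (rule member_le_sum[OF True _ finite_states])
        (simp add: weight_pos less_imp_le mult.assoc)
    then have "w x * (f x)\<^sup>2 \<le> 1" using that by (simp add: H_def power2_eq_square mult.assoc)
    then have sq: "(f x)\<^sup>2 \<le> 1 / w x"
      using weight_pos[OF True] by (simp add: field_simps)
    have "2 * \<bar>f x\<bar> \<le> 1 + (f x)\<^sup>2"
      using zero_le_power2[of "\<bar>f x\<bar> - 1"] by (simp add: power2_diff)
    then have "\<bar>f x\<bar> \<le> 1 + 1 / w x"
      using sq by (smt (verit) zero_le_power2)
    then show ?thesis using True by (simp add: R_def abs_le_iff)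
  next
    case False
    then show ?thesis using that by (simp add: H_def R_def)
  qed
  have "H = PiE UNIV R \<inter> H" using bound by auto
  then have "compact H" using compact_Int_closed[OF comp \<open>closed H\<close>] by simp
  have normalise: "(\<lambda>x. if x \<in> S then f x / sqrt (ip f f) else 0) \<in> H"
    if "ip f (\<lambda>_. 1) = 0" "0 < ip f f" for f
  proof -
    have "(\<Sum>x\<in>S. w x * (f x / sqrt (ip f f))) = 0"
      using that(1) by (simp add: weighted_inner_def sum_divide_distrib[symmetric])
    moreover have "(\<Sum>x\<in>S. w x * (f x / sqrt (ip f f)) * (f x / sqrt (ip f f))) = ip f f / ip f f"
      using that(2) unfolding weighted_inner_def[of S w f f, symmetric]
      by (simp add: sum_divide_distrib[symmetric] weighted_inner_def)
    ultimately show ?thesis using that(2) by (simp add: H_def weighted_inner_def)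
  qed
  \<comment> \<open>for distinct states \<open>x\<close> and \<open>y\<close>, the function \<open>w y\<close> at \<open>x\<close>, \<open>- w x\<close> at \<open>y\<close> has mean zero\<close>
  have "H \<noteq> {}"
  proof -
    obtain x y where xy: "x \<in> S" "y \<in> S" "x \<noteq> y"
      using assms card_le_Suc0_iff_eq[OF finite_states] by fastforce
    define f where "f z = (if z = x then w y else if z = y then - w x else 0)" for z
    have "ip f (\<lambda>_. 1) = (\<Sum>z\<in>S. (if z = x then w x * w y else 0) - (if z = y then w y * w x else 0))"
      unfolding weighted_inner_def by (rule sum.cong) (use xy in \<open>auto simp: f_def\<close>)
    also have "\<dots> = 0" using xy by (simp add: sum_subtractf finite_states)
    finally have "ip f (\<lambda>_. 1) = 0" .
    moreover have "0 < ip f f"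
      unfolding ip_pos_iff using xy weight_pos[of y] by (intro bexI[of _ x]) (auto simp: f_def)
    ultimately show ?thesis using normalise by blast
  qed
  obtain g where g: "g \<in> H" "\<And>f. f \<in> H \<Longrightarrow> ip f (op f) \<le> ip g (op g)"
    using continuous_attains_sup[OF \<open>compact H\<close> \<open>H \<noteq> {}\<close> cont_form] by blast
  show ?thesis
  proof (intro exI[of _ g] conjI allI impI)
    show "ip g (\<lambda>_. 1) = 0" "ip g g = 1" using g(1) by (auto simp: H_def)
    fix f assume f: "ip f (\<lambda>_. 1) = 0"
    show "ip f (op f) \<le> ip g (op g) * ip f f"
    proof (cases "0 < ip f f")
      case True
      define c where "c = sqrt (ip f f)"
      have c: "c \<noteq> 0" "c * c = ip f f" using True by (auto simp: c_def)
      define h where "h x = (if x \<in> S then f x / c else 0)" for x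
      have "h \<in> H" using normalise[OF f True] unfolding h_def c_def .
      have "op h x = op f x / c" for x
        by (simp add: kernel_op_def h_def sum_divide_distrib)
      then have "ip h (op h) = (\<Sum>x\<in>S. w x * f x * op f x / (c * c))"
        unfolding weighted_inner_def by (intro sum.cong[OF refl]) (simp add: h_def)
      then have "ip h (op h) = ip f (op f) / ip f f"
        by (simp add: weighted_inner_def sum_divide_distrib c(2))
      then show ?thesis using g(2)[OF \<open>h \<in> H\<close>] True by (simp add: pos_divide_le_eq)
    next
      case False
      then have "\<forall>x\<in>S. f x = 0" by (simp add: ip_pos_iff)
      then have "ip f (op f) = 0" "ip f f = 0" by (simp_all add: weighted_inner_def)
      then show ?thesis by simp
    qed
  qed
qed

text \<open>A maximiser \<open>g\<close> is an eigenfunction: the first variation of the Rayleigh quotient at \<open>g\<close> in the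
  direction \<open>h = K g - \<rho> g\<close>, which has mean zero, is a multiple of \<open>\<langle>h, h\<rangle>\<close>.\<close>

lemma rayleigh_max_eigenfunction:
  assumes "2 \<le> card S"
  shows "\<exists>g \<rho>. ip g (\<lambda>_. 1) = 0 \<and> (\<exists>x\<in>S. g x \<noteq> 0) \<and> (\<forall>x\<in>S. op g x = \<rho> * g x) \<and>
    (\<forall>f. ip f (\<lambda>_. 1) = 0 \<longrightarrow> ip f (op f) \<le> \<rho> * ip f f)"
proof -
  obtain g where g: "ip g (\<lambda>_. 1) = 0" "ip g g = 1"
    and max: "\<And>f. ip f (\<lambda>_. 1) = 0 \<Longrightarrow> ip f (op f) \<le> ip g (op g) * ip f f"
    using rayleigh_max_attained[OF assms] by blast
  define \<rho> where "\<rho> = ip g (op g)"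
  define h where "h = (\<lambda>x. 1 * op g x + (-\<rho>) * g x)"
  have h0: "ip h (\<lambda>_. 1) = 0"
    unfolding h_def ip_lincomb_left by (simp add: op_preserves_mean g(1))
  have hh: "ip h h = ip h (op g) - \<rho> * ip h g"
  proof -
    have "ip h h = ip (\<lambda>x. 1 * op g x + (-\<rho>) * g x) h" by (simp add: h_def)
    also have "\<dots> = ip h (op g) - \<rho> * ip h g"
      unfolding ip_lincomb_left by (simp add: ip_commute)
    finally show ?thesis .
  qed
  have variation: "2 * t * ip h h \<le> t\<^sup>2 * (\<rho> * ip h h - ip h (op h))" for t
  proof -
    let ?f = "\<lambda>x. 1 * g x + t * h x"
    have "ip ?f (\<lambda>_. 1) = 0" unfolding ip_lincomb_left by (simp add: g h0)
    from max[OF this] have le: "ip ?f (op ?f) \<le> \<rho> * ip ?f ?f" by (simp only: \<rho>_def)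
    have 1: "ip ?f (op ?f) = ip g (op g) + 2 * t * ip h (op g) + t\<^sup>2 * ip h (op h)"
    proof -
      have "ip ?f (op ?f) = ip g (op ?f) + t * ip h (op ?f)"
        unfolding ip_lincomb_left by simp
      also have "ip g (op ?f) = ip (op ?f) g" by (rule ip_commute)
      also have "ip (op ?f) g = ip g (op g) + t * ip h (op g)"
        unfolding op_lincomb ip_lincomb_left using op_self_adjoint[of h g] ip_commute[of "op g" g] by simp
      also have "ip h (op ?f) = ip (op ?f) h" by (rule ip_commute)
      also have "ip (op ?f) h = ip h (op g) + t * ip h (op h)"
        unfolding op_lincomb ip_lincomb_left by (simp add: ip_commute)
      finally show ?thesis by (simp add: algebra_simps power2_eq_square)
    qed
    have 2: "ip ?f ?f = ip g g + 2 * t * ip h g + t\<^sup>2 * ip h h"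
    proof -
      have "ip ?f ?f = ip g ?f + t * ip h ?f"
        unfolding ip_lincomb_left by simp
      also have "ip g ?f = ip ?f g" by (rule ip_commute)
      also have "ip ?f g = ip g g + t * ip h g"
        unfolding ip_lincomb_left by simp
      also have "ip h ?f = ip ?f h" by (rule ip_commute)
      also have "ip ?f h = ip h g + t * ip h h"
        unfolding ip_lincomb_left by (simp add: ip_commute)
      finally show ?thesis by (simp add: algebra_simps power2_eq_square)
    qed
    show ?thesis
      using le unfolding 1 2 hh \<rho>_def[symmetric] g(2) by (simp add: algebra_simps)
  qed
  have "ip h h = 0"
  proof (rule ccontr)
    assume "ip h h \<noteq> 0"
    then have pos: "0 < ip h h" using ip_nonneg[of h] by simp
    define c where "c = \<bar>\<rho> * ip h h - ip h (op h)\<bar> + 1"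
    have "0 < c" and c: "\<rho> * ip h h - ip h (op h) \<le> c" by (auto simp: c_def)
    \<comment> \<open>every \<open>t\<close> strictly between \<open>0\<close> and \<open>2 * ip h h / c\<close> contradicts the variation bound\<close>
    define t where "t = ip h h / c"
    have "0 < t" using pos \<open>0 < c\<close> by (simp add: t_def)
    have "2 * t * ip h h \<le> t\<^sup>2 * c"
      using variation[of t] mult_left_mono[OF c, of "t\<^sup>2"] by simp
    also have "t\<^sup>2 * c = t * ip h h"
      using \<open>0 < c\<close> by (simp add: t_def power2_eq_square)
    finally show False using \<open>0 < t\<close> pos by simp
  qed
  then have "\<forall>x\<in>S. h x = 0" using ip_pos_iff[of h] by auto
  then have "\<forall>x\<in>S. op g x = \<rho> * g x" by (simp add: h_def)
  moreover have "\<exists>x\<in>S. g x \<noteq> 0" using ip_pos_iff[of g] g(2) by simp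
  ultimately show ?thesis using g(1) max unfolding \<rho>_def by blast
qed

text \<open>Maximum principle: for an eigenvalue \<open>\<rho> \<ge> 1\<close>, the set where \<open>g\<close> takes its (positive) maximum is
  closed under the transitions, so \<open>g\<close> is a nonzero constant and does not have mean zero.\<close>

lemma irreducible_eigenvalue_less_one:
  assumes nonneg: "\<And>x y. x \<in> S \<Longrightarrow> y \<in> S \<Longrightarrow> 0 \<le> K x y"
    and irreducible: "irreducible_kernel S K"
    and mean: "ip g (\<lambda>_. 1) = 0" and nonzero: "\<exists>x\<in>S. g x \<noteq> 0"
    and eigen: "\<And>x. x \<in> S \<Longrightarrow> op g x = \<rho> * g x"
  shows "\<rho> < 1"
proof (rule ccontr)
  assume "\<not> \<rho> < 1"
  define M where "M = Max (g ` S)"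
  have ne: "S \<noteq> {}" using nonzero by auto
  have M: "g x \<le> M" if "x \<in> S" for x
    using that finite_states by (simp add: M_def)
  have "0 < M"
  proof (rule ccontr)
    assume "\<not> 0 < M"
    then have np: "0 \<le> w x * (- g x)" if "x \<in> S" for x
      using M[OF that] weight_pos[OF that] by (intro mult_nonneg_nonneg) auto
    have "(\<Sum>x\<in>S. w x * (- g x)) = 0"
      using mean by (simp add: weighted_inner_def sum_negf)
    then have "\<forall>x\<in>S. w x * (- g x) = 0"
      using sum_nonneg_eq_0_iff[OF finite_states np] by simp
    then show False using nonzero weight_pos by fastforce
  qed
  define T where "T = {x \<in> S. g x = M}"
  have "T = S"
  proof (rule irreducible[unfolded irreducible_kernel_def, rule_format])
    show "T \<subseteq> S" by (auto simp: T_def)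
    have "M \<in> g ` S" unfolding M_def using finite_states ne by (intro Max_in) auto
    then show "T \<noteq> {}" by (auto simp: T_def)
    fix x y assume x: "x \<in> T" and y: "y \<in> S" "0 < K x y"
    have xS: "x \<in> S" and gx: "g x = M" using x by (auto simp: T_def)
    have nn: "0 \<le> K x z * (M - g z)" if "z \<in> S" for z
      using nonneg[OF xS that] M[OF that] by simp
    have "(\<Sum>z\<in>S. K x z * (M - g z)) = M - \<rho> * M"
      using eigen[OF xS] row_sum[OF xS]
      by (simp add: gx kernel_op_def right_diff_distrib sum_subtractf sum_distrib_right[symmetric])
    also have "\<dots> \<le> 0" using \<open>\<not> \<rho> < 1\<close> \<open>0 < M\<close> by simp
    finally have "(\<Sum>z\<in>S. K x z * (M - g z)) = 0" using sum_nonneg[of S "\<lambda>z. K x z * (M - g z)"] nn by simp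
    then have "K x y * (M - g y) = 0"
      using sum_nonneg_eq_0_iff[of S "\<lambda>z. K x z * (M - g z)"] finite_states nn y(1) by simp
    then show "y \<in> T" using y by (auto simp: T_def)
  qed
  then have "(\<Sum>x\<in>S. w x * M) = 0"
    using mean unfolding weighted_inner_def T_def by (subst sum.cong[OF refl, of _ _ "\<lambda>x. w x * g x * 1"]) auto
  moreover have "0 < (\<Sum>x\<in>S. w x * M)"
    using finite_states ne weight_pos \<open>0 < M\<close> by (intro sum_pos) auto
  ultimately show False by simp
qed

end

section \<open>Comparison of spectral gaps\<close>

lemma eigenvalue_transition_mat_iff:
  assumes "finite S"
  shows "eigenvalue (transition_mat S K) \<xi> \<longleftrightarrow>
    (\<exists>v. (\<exists>x\<in>S. v x \<noteq> 0) \<and> (\<forall>x\<in>S. (\<Sum>y\<in>S. complex_of_real (K x y) * v y) = \<xi> * v x))"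
proof -
  define n where "n = card S"
  define a where "a = from_nat_into S"
  have bij: "bij_betw a {0..<n} S"
    using bij_betw_from_nat_into_finite[OF assms] by (simp add: a_def n_def atLeast0LessThan)
  define b where "b = the_inv_into {0..<n} a"
  have ab: "a (b x) = x" "b x < n" if "x \<in> S" for x
    using that bij f_the_inv_into_f_bij_betw[OF bij] the_inv_into_into[of a "{0..<n}" x "{0..<n}"]
    by (auto simp: b_def bij_betw_def)
  have aS: "a i \<in> S" if "i < n" for i
    using bij that by (auto simp: bij_betw_def)
  have ball: "(\<forall>x\<in>S. P x) \<longleftrightarrow> (\<forall>i<n. P (a i))" for P using ab aS by metis
  have row: "(transition_mat S K *\<^sub>v u) $ i = (\<Sum>y\<in>S. complex_of_real (K (a i) y) * v y)"
    if "u \<in> carrier_vec n" "i < n" "\<And>j. j < n \<Longrightarrow> u $ j = v (a j)" for u v i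
  proof -
    have "(transition_mat S K *\<^sub>v u) $ i = (\<Sum>j\<in>{0..<n}. complex_of_real (K (a i) (a j)) * v (a j))"
      using that by (simp add: transition_mat_def n_def[symmetric] a_def[symmetric] scalar_prod_def)
    also have "\<dots> = (\<Sum>y\<in>S. complex_of_real (K (a i) y) * v y)"
      by (rule sum.reindex_bij_betw[OF bij])
    finally show ?thesis .
  qed
  have dim: "dim_row (transition_mat S K) = n" by (simp add: transition_mat_def n_def)
  show ?thesis
  proof
    assume "eigenvalue (transition_mat S K) \<xi>"
    then obtain u where u: "u \<in> carrier_vec n" "u \<noteq> 0\<^sub>v n" "transition_mat S K *\<^sub>v u = \<xi> \<cdot>\<^sub>v u"
      by (auto simp: eigenvalue_def eigenvector_def dim)
    define v where "v x = u $ b x" for x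
    have ba: "b (a i) = i" if "i < n" for i
      using that bij by (simp add: b_def bij_betw_def the_inv_into_f_f)
    have uv: "u $ j = v (a j)" if "j < n" for j using that by (simp add: v_def ba)
    have "\<exists>i<n. u $ i \<noteq> 0" using u(1,2) by auto
    then have "\<exists>x\<in>S. v x \<noteq> 0" using uv aS by metis
    moreover have "\<forall>i<n. (\<Sum>y\<in>S. complex_of_real (K (a i) y) * v y) = \<xi> * v (a i)"
      using row[OF u(1) _ uv] u by (auto simp: uv)
    ultimately show "\<exists>v. (\<exists>x\<in>S. v x \<noteq> 0) \<and>
        (\<forall>x\<in>S. (\<Sum>y\<in>S. complex_of_real (K x y) * v y) = \<xi> * v x)"
      unfolding ball by blast
  next
    assume "\<exists>v. (\<exists>x\<in>S. v x \<noteq> 0) \<and>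
        (\<forall>x\<in>S. (\<Sum>y\<in>S. complex_of_real (K x y) * v y) = \<xi> * v x)"
    then obtain v where v: "\<exists>x\<in>S. v x \<noteq> 0"
      "\<forall>i<n. (\<Sum>y\<in>S. complex_of_real (K (a i) y) * v y) = \<xi> * v (a i)"
      unfolding ball by blast
    define u where "u = vec n (\<lambda>i. v (a i))"
    have u: "u \<in> carrier_vec n" by (simp add: u_def)
    have uv: "u $ j = v (a j)" if "j < n" for j using that by (simp add: u_def)
    have "transition_mat S K *\<^sub>v u = \<xi> \<cdot>\<^sub>v u"
    proof (rule eq_vecI)
      fix i assume "i < dim_vec (\<xi> \<cdot>\<^sub>v u)"
      then have "i < n" using u by simp
      then show "(transition_mat S K *\<^sub>v u) $ i = (\<xi> \<cdot>\<^sub>v u) $ i"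
        using row[OF u \<open>i < n\<close> uv] v(2) u by (simp add: uv)
    qed (use u dim in simp)
    moreover have "u \<noteq> 0\<^sub>v n"
    proof
      assume "u = 0\<^sub>v n"
      then have "\<forall>i<n. v (a i) = 0" using uv by simp
      then show False using v(1) ball[of "\<lambda>x. v x = 0"] by blast
    qed
    ultimately show "eigenvalue (transition_mat S K) \<xi>"
      using u by (auto simp: eigenvalue_def eigenvector_def dim)
  qed
qed

lemma finite_eigenvalues_transition_mat:
  "finite {\<xi>. eigenvalue (transition_mat S K) \<xi>}"
proof -
  let ?A = "transition_mat S K"
  have A: "?A \<in> carrier_mat (card S) (card S)" by (simp add: transition_mat_def)
  have "char_poly ?A \<noteq> 0" using degree_monic_char_poly[OF A] by (metis coeff_0 zero_neq_one)
  then show ?thesis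
    unfolding eigenvalue_root_char_poly[OF A] by (rule poly_roots_finite)
qed

text \<open>Pairing the eigenvalue equation of a complex eigenvector \<open>a + \<i> b\<close> with the vector itself
  expresses \<open>\<xi>\<close> by the forms of the real functions \<open>a\<close> and \<open>b\<close>, which have mean zero since \<open>\<xi> \<noteq> 1\<close>.\<close>

lemma (in reversible_kernel) eigenvalue_transition_mat_bounds:
  assumes nonneg: "\<And>f. 0 \<le> ip f (op f)"
    and upper: "\<And>f. ip f (\<lambda>_. 1) = 0 \<Longrightarrow> ip f (op f) \<le> \<rho> * ip f f"
    and ev: "eigenvalue (transition_mat S K) \<xi>" and ne1: "\<xi> \<noteq> 1"
  shows "cmod \<xi> \<le> \<rho>"
proof -
  obtain v where v: "\<exists>x\<in>S. v x \<noteq> 0"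
    "\<And>x. x \<in> S \<Longrightarrow> (\<Sum>y\<in>S. complex_of_real (K x y) * v y) = \<xi> * v x"
    using ev unfolding eigenvalue_transition_mat_iff[OF finite_states] by blast
  define a where "a x = Re (v x)" for x
  define b where "b x = Im (v x)" for x
  have vab: "v x = complex_of_real (a x) + \<i> * complex_of_real (b x)" for x
    by (simp add: a_def b_def complex_eq)
  have Kv: "\<xi> * v x = complex_of_real (op a x) + \<i> * complex_of_real (op b x)" if "x \<in> S" for x
    unfolding v(2)[OF that, symmetric]
    by (simp add: kernel_op_def vab ring_distribs sum.distrib sum_distrib_left mult_ac)
  have mean: "ip a (\<lambda>_. 1) = 0 \<and> ip b (\<lambda>_. 1) = 0"
  proof -
    let ?m = "complex_of_real (ip a (\<lambda>_. 1)) + \<i> * complex_of_real (ip b (\<lambda>_. 1))"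
    have m: "?m = (\<Sum>x\<in>S. complex_of_real (w x) * v x)"
      by (simp add: weighted_inner_def vab ring_distribs sum.distrib sum_distrib_left mult_ac)
    have "\<xi> * ?m = (\<Sum>x\<in>S. complex_of_real (w x) * (\<xi> * v x))"
      unfolding m sum_distrib_left by (simp add: mult_ac)
    also have "\<dots> = complex_of_real (ip (op a) (\<lambda>_. 1)) + \<i> * complex_of_real (ip (op b) (\<lambda>_. 1))"
      by (simp add: Kv weighted_inner_def ring_distribs sum.distrib sum_distrib_left mult_ac)
    also have "\<dots> = ?m" by (simp add: op_preserves_mean)
    finally have "?m = 0" using ne1 by simp
    then show ?thesis by (simp add: complex_eq_iff)
  qed
  \<comment> \<open>the squared norm and the quadratic form of \<open>v\<close>\<close>
  let ?N = "ip a a + ip b b" and ?Q = "ip a (op a) + ip b (op b)"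
  have "\<xi> * complex_of_real ?N = (\<Sum>x\<in>S. complex_of_real (w x) * (cnj (v x) * (\<xi> * v x)))"
    by (simp add: weighted_inner_def sum_distrib_left sum.distrib[symmetric] vab algebra_simps)
  also have "\<dots> = (\<Sum>x\<in>S. complex_of_real (w x) * (cnj (v x) *
      (complex_of_real (op a x) + \<i> * complex_of_real (op b x))))"
    by (simp add: Kv)
  also have "\<dots> = complex_of_real ?Q + \<i> * complex_of_real (ip a (op b) - ip b (op a))"
    by (simp add: weighted_inner_def sum_distrib_left sum.distrib[symmetric]
        sum_subtractf[symmetric] vab algebra_simps)
  also have "ip a (op b) - ip b (op a) = 0"
    using op_self_adjoint[of a b] by (simp add: ip_commute)
  finally have eq: "\<xi> * complex_of_real ?N = complex_of_real ?Q" by simp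
  have "0 < ip a a \<or> 0 < ip b b"
    using v(1) unfolding ip_pos_iff by (auto simp: a_def b_def complex_eq_iff)
  then have "0 < ?N" using ip_nonneg[of a] ip_nonneg[of b] by linarith
  have "0 \<le> ?Q" using nonneg[of a] nonneg[of b] by simp
  have "cmod \<xi> * ?N = cmod (\<xi> * complex_of_real ?N)" using \<open>0 < ?N\<close> by (simp add: norm_mult del: of_real_add)
  also have "\<dots> = ?Q" unfolding eq using \<open>0 \<le> ?Q\<close> by (simp del: of_real_add)
  also have "\<dots> \<le> \<rho> * ?N"
    using upper[of a] upper[of b] mean by (simp add: ring_distribs)
  finally show ?thesis using \<open>0 < ?N\<close> by simp
qed

lemma (in reversible_kernel) eigenvalue_transition_matI:
  assumes "\<exists>x\<in>S. g x \<noteq> 0" "\<And>x. x \<in> S \<Longrightarrow> op g x = \<rho> * g x"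
  shows "eigenvalue (transition_mat S K) (complex_of_real \<rho>)"
  unfolding eigenvalue_transition_mat_iff[OF finite_states]
proof (intro exI conjI ballI)
  show "\<exists>x\<in>S. complex_of_real (g x) \<noteq> 0" using assms(1) by simp
  fix x assume "x \<in> S"
  have "(\<Sum>y\<in>S. complex_of_real (K x y) * complex_of_real (g y)) = complex_of_real (op g x)"
    by (simp add: kernel_op_def)
  then show "(\<Sum>y\<in>S. complex_of_real (K x y) * complex_of_real (g y)) = complex_of_real \<rho> * complex_of_real (g x)"
    by (simp add: assms(2)[OF \<open>x \<in> S\<close>])
qed

text \<open>The larger form gives the smaller gap. Nonnegativity of the smaller form rules out that an
  eigenvalue near \<open>-1\<close> determines the gap of \<open>K\<close>.\<close>

theorem spectral_gap_mono_form:
  assumes K: "reversible_kernel S w K" and L: "reversible_kernel S w L" and card: "2 \<le> card S"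
    and nonneg: "\<And>f. 0 \<le> weighted_inner S w f (kernel_op S K f)"
    and le: "\<And>f. weighted_inner S w f (kernel_op S K f) \<le> weighted_inner S w f (kernel_op S L f)"
    and L_nonneg: "\<And>x y. x \<in> S \<Longrightarrow> y \<in> S \<Longrightarrow> 0 \<le> L x y"
    and irreducible: "irreducible_kernel S L"
  shows "spectral_gap S L \<le> spectral_gap S K"
proof -
  interpret K: reversible_kernel S w K by (rule K)
  interpret L: reversible_kernel S w L by (rule L)
  obtain g \<rho> where g: "L.ip g (\<lambda>_. 1) = 0" "\<exists>x\<in>S. g x \<noteq> 0" "\<forall>x\<in>S. L.op g x = \<rho> * g x"
    and \<rho>: "\<forall>f. L.ip f (\<lambda>_. 1) = 0 \<longrightarrow> L.ip f (L.op f) \<le> \<rho> * L.ip f f"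
    using L.rayleigh_max_eigenfunction[OF card] by (elim exE conjE) (rule that)
  have "\<rho> < 1" by (rule L.irreducible_eigenvalue_less_one[OF L_nonneg irreducible g(1,2) bspec[OF g(3)]])
  have \<rho>': "K.ip f (K.op f) \<le> \<rho> * K.ip f f" if "K.ip f (\<lambda>_. 1) = 0" for f
    using le[of f] \<rho> that by fastforce
  let ?M = "\<lambda>P. {cmod \<xi> | \<xi>. eigenvalue (transition_mat S P) \<xi> \<and> \<xi> \<noteq> 1}"
  have fin: "finite (?M P)" for P
    by (rule finite_subset[OF _ finite_imageI[OF finite_eigenvalues_transition_mat[of S P], of cmod]])
      auto
  have "\<bar>\<rho>\<bar> \<in> ?M L"
    using L.eigenvalue_transition_matI[OF g(2) bspec[OF g(3)]] \<open>\<rho> < 1\<close>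
    by (intro CollectI exI[of _ "complex_of_real \<rho>"]) auto
  then have "\<rho> \<le> Max (?M L)" using Max_ge[OF fin, of "\<bar>\<rho>\<bar>" L] by linarith
  \<comment> \<open>the value of \<open>Max\<close> on the empty set is unspecified\<close>
  have "?M K \<noteq> {}"
  proof -
    obtain h \<kappa> where h: "K.ip h (\<lambda>_. 1) = 0" "\<exists>x\<in>S. h x \<noteq> 0" "\<forall>x\<in>S. K.op h x = \<kappa> * h x"
      using K.rayleigh_max_eigenfunction[OF card] by (elim exE conjE) (rule that)
    have "K.ip h (K.op h) = \<kappa> * K.ip h h"
      using h(3) by (simp add: weighted_inner_def sum_distrib_left mult_ac)
    moreover have "0 < K.ip h h" using h(2) by (simp add: K.ip_pos_iff)
    ultimately have "\<kappa> \<le> \<rho>" using \<rho>'[OF h(1)] by simp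
    then have "complex_of_real \<kappa> \<noteq> 1" using \<open>\<rho> < 1\<close> by simp
    then show ?thesis using K.eigenvalue_transition_matI[OF h(2) bspec[OF h(3)]] by blast
  qed
  then have "Max (?M K) \<in> ?M K" by (rule Max_in[OF fin])
  then obtain \<xi> where "Max (?M K) = cmod \<xi>" "eigenvalue (transition_mat S K) \<xi>" "\<xi> \<noteq> 1" by auto
  moreover from this(2,3) have "cmod \<xi> \<le> \<rho>"
    by (intro K.eigenvalue_transition_mat_bounds[of \<rho> \<xi>] nonneg \<rho>')
  ultimately have "Max (?M K) \<le> \<rho>" by simp
  then show ?thesis unfolding spectral_gap_def using \<open>\<rho> \<le> Max (?M L)\<close> by linarith
qed

section \<open>Connectivity and single-edge updates\<close>

lemma refl_conn [simp]: "(u, u) \<in> conn A"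
  by (simp add: conn_def)

lemma conn_sym: "(u, v) \<in> conn A \<Longrightarrow> (v, u) \<in> conn A"
proof -
  have "sym {(u, v). {u, v} \<in> A}" by (auto simp: sym_def insert_commute)
  then show "(u, v) \<in> conn A \<Longrightarrow> (v, u) \<in> conn A"
    unfolding conn_def by (metis symD sym_rtrancl)
qed

lemma conn_trans: "(u, v) \<in> conn A \<Longrightarrow> (v, x) \<in> conn A \<Longrightarrow> (u, x) \<in> conn A"
  unfolding conn_def by (rule rtrancl_trans)

lemma conn_class_eq: "conn A `` {u} = conn A `` {v} \<longleftrightarrow> (u, v) \<in> conn A"
  by (auto intro: conn_sym conn_trans)

lemma conn_edge: "{u, v} \<in> A \<Longrightarrow> (u, v) \<in> conn A"
  by (auto simp: conn_def)

lemma compatible_coloring_constant_on_conn: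
  assumes "\<sigma> \<in> compatible_colorings V q A" "(u, v) \<in> conn A"
  shows "\<sigma> u = \<sigma> v"
  using assms(2) unfolding conn_def
  by (induction rule: rtrancl_induct) (use assms(1) in \<open>auto simp: compatible_colorings_def\<close>)

text \<open>The probability that the update of \<open>e\<close> from the state \<open>A\<close> leaves \<open>e\<close> present.\<close>

definition edge_prob :: "real \<Rightarrow> nat \<Rightarrow> 'v set \<Rightarrow> 'v set set \<Rightarrow> real" where
  "edge_prob p q e A = (if \<exists>u v. e = {u, v} \<and> (u, v) \<in> conn A then p else p / real q)"

lemma P_edge_eq_0: "\<not> sym_diff A B \<subseteq> {e} \<Longrightarrow> P_edge p q e A B = 0"
  unfolding P_edge_def by (rule if_not_P)

lemma P_edge_insert: "P_edge p q e A (insert e A) = edge_prob p q e A"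
proof -
  have "sym_diff A (insert e A) \<subseteq> {e}" "insert e A \<inter> {e} = {e}" by auto
  then show ?thesis unfolding P_edge_def edge_prob_def by auto
qed

lemma P_edge_remove: "P_edge p q e A (A - {e}) = 1 - edge_prob p q e A"
proof -
  have "sym_diff A (A - {e}) \<subseteq> {e}" "(A - {e}) \<inter> {e} = {}" by auto
  then show ?thesis unfolding P_edge_def edge_prob_def by auto
qed

lemma kernel_op_P_edge:
  assumes "finite E" "A \<subseteq> E" "e \<in> E"
  shows "kernel_op (Pow E) (P_edge p q e) f A =
    edge_prob p q e A * f (insert e A) + (1 - edge_prob p q e A) * f (A - {e})"
proof -
  have "kernel_op (Pow E) (P_edge p q e) f A =
      (\<Sum>B\<in>{insert e A, A - {e}}. P_edge p q e A B * f B)"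
    unfolding kernel_op_def
  proof (rule sum.mono_neutral_right)
    show "\<forall>B\<in>Pow E - {insert e A, A - {e}}. P_edge p q e A B * f B = 0"
    proof
      fix B assume "B \<in> Pow E - {insert e A, A - {e}}"
      then have "B \<noteq> insert e A" "B \<noteq> A - {e}" by auto
      then have "\<not> sym_diff A B \<subseteq> {e}" by blast
      then show "P_edge p q e A B * f B = 0" by (simp add: P_edge_eq_0)
    qed
  qed (use assms in auto)
  moreover have "insert e A \<noteq> A - {e}" by blast
  ultimately show ?thesis by (simp add: P_edge_insert P_edge_remove)
qed

section \<open>Counting compatible colorings\<close>

locale random_cluster =
  fixes V :: "'v set" and E :: "'v set set" and p :: real and q :: nat
  assumes graph: "finite_graph V E"
    and p_pos: "0 < p" and p_less_1: "p < 1" and q_pos: "1 \<le> q"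
begin

text \<open>The weight of a single edge in the random-cluster measure.\<close>

definition odds :: real where
  "odds = p / (1 - p)"

text \<open>The random-cluster measure without its normalising constant.\<close>

definition rc_weight :: "'v set set \<Rightarrow> real" where
  "rc_weight A = odds ^ card A * real q ^ ncomp V A"

lemma odds_pos: "0 < odds" and one_plus_odds: "1 + odds = 1 / (1 - p)"
  using p_pos p_less_1 by (simp_all add: odds_def field_simps)

lemma finite_V: "finite V"
  using graph by (simp add: finite_graph_def)

lemma edgeE:
  assumes "e \<in> E"
  obtains u v where "u \<in> V" "v \<in> V" "u \<noteq> v" "e = {u, v}"
  using assms graph unfolding finite_graph_def by metis

lemma edge_subset: "{u, v} \<in> E \<Longrightarrow> u \<in> V \<and> v \<in> V"
  by (metis edgeE insert_iff singletonD)

lemma finite_E: "finite E"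
proof -
  have "E \<subseteq> Pow V" by (auto elim!: edgeE)
  then show ?thesis using finite_V finite_subset by blast
qed

lemma finite_edge_subset: "A \<subseteq> E \<Longrightarrow> finite A"
  using finite_E finite_subset by blast

lemma finite_colorings: "finite (colorings V q)"
  using finite_V by (simp add: colorings_def finite_PiE)

lemma finite_compatible_colorings: "finite (compatible_colorings V q A)"
  using finite_colorings by (simp add: compatible_colorings_def)

lemma conn_in_V:
  assumes "(u, v) \<in> conn A" "A \<subseteq> E" "u \<in> V"
  shows "v \<in> V"
  using assms(1) unfolding conn_def
  by (induction rule: rtrancl_induct) (use assms edge_subset in auto)

text \<open>The compatible colorings are the functions of the component.\<close>

lemma card_compatible_colorings:
  assumes "A \<subseteq> E"
  shows "card (compatible_colorings V q A) = q ^ ncomp V A"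
proof -
  let ?Q = "V // conn A"
  let ?cl = "\<lambda>x. conn A `` {x}"
  have Q: "?Q = ?cl ` V" by (auto simp: quotient_def)
  then have "finite ?Q" using finite_V by simp
  define F where "F f = (\<lambda>x\<in>V. f (?cl x))" for f :: "'v set \<Rightarrow> nat"
  have "bij_betw F (?Q \<rightarrow>\<^sub>E {1..q}) (compatible_colorings V q A)"
    unfolding bij_betw_def
  proof
    show "inj_on F (?Q \<rightarrow>\<^sub>E {1..q})"
    proof (rule inj_onI)
      fix f g assume f: "f \<in> ?Q \<rightarrow>\<^sub>E {1..q}" and g: "g \<in> ?Q \<rightarrow>\<^sub>E {1..q}" and eq: "F f = F g"
      show "f = g"
      proof (rule PiE_ext[OF f g])
        fix C assume "C \<in> ?Q"
        then obtain x where "x \<in> V" "C = ?cl x" unfolding Q by blast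
        then show "f C = g C" using fun_cong[OF eq, of x] by (simp add: F_def)
      qed
    qed
    show "F ` (?Q \<rightarrow>\<^sub>E {1..q}) = compatible_colorings V q A"
    proof
      show "F ` (?Q \<rightarrow>\<^sub>E {1..q}) \<subseteq> compatible_colorings V q A"
      proof
        fix \<sigma> assume "\<sigma> \<in> F ` (?Q \<rightarrow>\<^sub>E {1..q})"
        then obtain f where f: "f \<in> ?Q \<rightarrow>\<^sub>E {1..q}" and \<sigma>: "\<sigma> = F f" by blast
        have "F f \<in> V \<rightarrow>\<^sub>E {1..q}"
          using f unfolding F_def Q by (intro restrict_PiE_iff[THEN iffD2] ballI) (auto dest: PiE_mem)
        moreover have "F f u = F f v" if "{u, v} \<in> A" for u v
        proof -
          have "u \<in> V" "v \<in> V" using that assms edge_subset by blast+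
          moreover have "?cl u = ?cl v" using that by (simp add: conn_class_eq conn_edge)
          ultimately show ?thesis by (simp add: F_def)
        qed
        ultimately show "\<sigma> \<in> compatible_colorings V q A"
          unfolding \<sigma> compatible_colorings_def colorings_def by blast
      qed
      show "compatible_colorings V q A \<subseteq> F ` (?Q \<rightarrow>\<^sub>E {1..q})"
      proof
        fix \<sigma> assume \<sigma>: "\<sigma> \<in> compatible_colorings V q A"
        define f where "f = (\<lambda>C\<in>?Q. \<sigma> (SOME x. x \<in> C))"
        have f: "f (?cl x) = \<sigma> x" if "x \<in> V" for x
        proof -
          have "(SOME y. y \<in> ?cl x) \<in> ?cl x" by (rule someI[of _ x]) simp
          then have "\<sigma> x = \<sigma> (SOME y. y \<in> ?cl x)"
            using compatible_coloring_constant_on_conn[OF \<sigma>] by blast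
          then show ?thesis using that by (simp add: f_def Q)
        qed
        have \<sigma>V: "\<sigma> \<in> V \<rightarrow>\<^sub>E {1..q}" using \<sigma> by (simp add: compatible_colorings_def colorings_def)
        have "f \<in> ?Q \<rightarrow>\<^sub>E {1..q}"
        proof (rule PiE_I)
          fix C assume "C \<in> ?Q"
          then obtain x where "x \<in> V" "C = ?cl x" unfolding Q by blast
          then show "f C \<in> {1..q}" using f PiE_mem[OF \<sigma>V] by metis
        qed (simp add: f_def)
        moreover have "F f = \<sigma>"
        proof
          show "F f x = \<sigma> x" for x
            by (cases "x \<in> V") (simp_all add: F_def f PiE_arb[OF \<sigma>V])
        qed
        ultimately show "\<sigma> \<in> F ` (?Q \<rightarrow>\<^sub>E {1..q})" by blast
      qed
    qed
  qed
  then have "card (compatible_colorings V q A) = card (?Q \<rightarrow>\<^sub>E {1..q})"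
    by (simp add: bij_betw_same_card)
  also have "\<dots> = q ^ card ?Q" using \<open>finite ?Q\<close> by (simp add: card_PiE)
  finally show ?thesis by (simp add: ncomp_def)
qed

lemma edge_in_mono_edges_iff:
  assumes "{u, v} \<in> E"
  shows "{u, v} \<in> mono_edges E \<sigma> \<longleftrightarrow> \<sigma> u = \<sigma> v"
  using assms unfolding mono_edges_def by (auto simp: doubleton_eq_iff)

lemma mono_edges_subset: "mono_edges E \<sigma> \<subseteq> E"
  by (auto simp: mono_edges_def)

lemma finite_mono_edges: "finite (mono_edges E \<sigma>)"
  using mono_edges_subset by (rule finite_edge_subset)

lemma compatible_colorings_iff:
  assumes "A \<subseteq> E"
  shows "\<sigma> \<in> compatible_colorings V q A \<longleftrightarrow> \<sigma> \<in> colorings V q \<and> A \<subseteq> mono_edges E \<sigma>"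
proof -
  have "(\<forall>u v. {u, v} \<in> A \<longrightarrow> \<sigma> u = \<sigma> v) \<longleftrightarrow> A \<subseteq> mono_edges E \<sigma>"
  proof
    assume *: "\<forall>u v. {u, v} \<in> A \<longrightarrow> \<sigma> u = \<sigma> v"
    show "A \<subseteq> mono_edges E \<sigma>"
    proof
      fix e assume "e \<in> A"
      then have "e \<in> E" using assms by blast
      then obtain u v where "e = {u, v}" by (rule edgeE)
      then show "e \<in> mono_edges E \<sigma>"
        using * \<open>e \<in> A\<close> \<open>e \<in> E\<close> by (simp add: edge_in_mono_edges_iff)
    qed
  next
    assume "A \<subseteq> mono_edges E \<sigma>"
    then show "\<forall>u v. {u, v} \<in> A \<longrightarrow> \<sigma> u = \<sigma> v"
      using assms edge_in_mono_edges_iff by blast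
  qed
  then show ?thesis by (simp add: compatible_colorings_def)
qed

lemma compatible_colorings_insert:
  assumes "A \<subseteq> E" "e \<in> E"
  shows "compatible_colorings V q (insert e A) =
    {\<sigma> \<in> compatible_colorings V q A. e \<in> mono_edges E \<sigma>}"
  using assms by (auto simp: compatible_colorings_iff)

text \<open>Recoloring the component of \<open>u\<close> by an arbitrary color turns a coloring that agrees at \<open>u\<close> and \<open>v\<close>
  into an arbitrary coloring compatible with \<open>A\<close>; the inverse records the color of \<open>u\<close> and recolors
  by the color of \<open>v\<close>.\<close>

lemma card_compatible_colorings_insert:
  assumes "A \<subseteq> E" "{u, v} \<in> E" "(u, v) \<notin> conn A"
  shows "card (compatible_colorings V q (insert {u, v} A)) * q =
    card (compatible_colorings V q A)"
proof -
  let ?C = "compatible_colorings V q A"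
  let ?D = "compatible_colorings V q (insert {u, v} A)"
  have D: "?D = {\<sigma> \<in> ?C. \<sigma> u = \<sigma> v}"
    using assms(2) by (simp add: compatible_colorings_insert[OF assms(1,2)] edge_in_mono_edges_iff)
  have uV: "u \<in> V" "v \<in> V" using edge_subset[OF assms(2)] by auto
  define F where "F = (\<lambda>(\<sigma> :: 'v \<Rightarrow> nat, t) x. if (u, x) \<in> conn A then t else \<sigma> x)"
  have CV: "\<sigma> \<in> V \<rightarrow>\<^sub>E {1..q}" if "\<sigma> \<in> ?C" for \<sigma>
    using that by (simp add: compatible_colorings_def colorings_def)
  have F_mem: "F (\<sigma>, t) \<in> ?C" if "\<sigma> \<in> ?C" "t \<in> {1..q}" for \<sigma> t
  proof -
    have "F (\<sigma>, t) \<in> V \<rightarrow>\<^sub>E {1..q}"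
    proof (rule PiE_I)
      fix x assume "x \<in> V"
      then show "F (\<sigma>, t) x \<in> {1..q}"
        using that PiE_mem[OF CV[OF that(1)], of x] by (simp add: F_def)
    next
      fix x assume "x \<notin> V"
      then have "(u, x) \<notin> conn A" using conn_in_V assms(1) uV by blast
      then show "F (\<sigma>, t) x = undefined"
        using PiE_arb[OF CV[OF that(1)] \<open>x \<notin> V\<close>] by (simp add: F_def)
    qed
    moreover have "F (\<sigma>, t) x = F (\<sigma>, t) y" if "{x, y} \<in> A" for x y
    proof -
      have "(u, x) \<in> conn A \<longleftrightarrow> (u, y) \<in> conn A"
        using conn_edge[OF that] conn_sym conn_trans by metis
      then show ?thesis using \<open>\<sigma> \<in> ?C\<close> that by (auto simp: F_def compatible_colorings_def)
    qed
    ultimately show ?thesis by (simp add: compatible_colorings_def colorings_def)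
  qed
  have range: "\<tau> x \<in> {1..q}" if "\<tau> \<in> ?C" "x \<in> V" for \<tau> x
    using PiE_mem[OF CV[OF that(1)] that(2)] .
  have "bij_betw F (?D \<times> {1..q}) ?C"
  proof (rule bij_betw_byWitness[where f' = "\<lambda>\<tau>. (F (\<tau>, \<tau> v), \<tau> u)"])
    show "\<forall>a\<in>?D \<times> {1..q}. (F (F a, F a v), F a u) = a"
    proof
      fix a assume "a \<in> ?D \<times> {1..q}"
      then obtain \<sigma> t where a: "a = (\<sigma>, t)" "\<sigma> \<in> ?C" "\<sigma> u = \<sigma> v" unfolding D by auto
      have "F (F a, F a v) = \<sigma>"
        using compatible_coloring_constant_on_conn[OF a(2), of u] assms(3) a(1,3)
        by (auto simp: F_def fun_eq_iff)
      then show "(F (F a, F a v), F a u) = a" using a(1) by (simp add: F_def)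
    qed
    show "\<forall>\<tau>\<in>?C. F (F (\<tau>, \<tau> v), \<tau> u) = \<tau>"
      using compatible_coloring_constant_on_conn[of _ V q A u] by (auto simp: F_def fun_eq_iff)
    show "F ` (?D \<times> {1..q}) \<subseteq> ?C" using F_mem D by auto
    show "(\<lambda>\<tau>. (F (\<tau>, \<tau> v), \<tau> u)) ` ?C \<subseteq> ?D \<times> {1..q}"
    proof
      fix z assume "z \<in> (\<lambda>\<tau>. (F (\<tau>, \<tau> v), \<tau> u)) ` ?C"
      then obtain \<tau> where \<tau>: "\<tau> \<in> ?C" and z: "z = (F (\<tau>, \<tau> v), \<tau> u)" by blast
      have "F (\<tau>, \<tau> v) \<in> ?D"
        unfolding D using F_mem[OF \<tau> range[OF \<tau> uV(2)]] assms(3) by (simp add: F_def)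
      then show "z \<in> ?D \<times> {1..q}" unfolding z using range[OF \<tau> uV(1)] by blast
    qed
  qed
  then have "card (?D \<times> {1..q}) = card ?C" by (rule bij_betw_same_card)
  then show ?thesis by (simp add: card_cartesian_product)
qed

text \<open>Joining two components by \<open>e\<close> loses a factor \<open>q\<close> in the number of colorings, which is the
  factor between the two cases of \<open>edge_prob\<close>.\<close>

lemma edge_prob_ncomp:
  assumes "A \<subseteq> E" "e \<in> E"
  shows "real q ^ ncomp V A * edge_prob p q e A = p * real q ^ ncomp V (insert e A)"
proof -
  obtain u v where uv: "e = {u, v}" using assms(2) by (rule edgeE)
  have iff: "(\<exists>x y. e = {x, y} \<and> (x, y) \<in> conn A) \<longleftrightarrow> (u, v) \<in> conn A"
    unfolding uv using conn_sym by (fastforce simp: doubleton_eq_iff)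
  have card: "real q ^ ncomp V B = real (card (compatible_colorings V q B))" if "B \<subseteq> E" for B
    by (simp add: card_compatible_colorings[OF that])
  have sub: "insert e A \<subseteq> E" using assms by simp
  show ?thesis
  proof (cases "(u, v) \<in> conn A")
    case True
    have "compatible_colorings V q (insert e A) = compatible_colorings V q A"
      unfolding compatible_colorings_insert[OF assms]
      using compatible_coloring_constant_on_conn[OF _ True] assms(2) edge_in_mono_edges_iff[of u v]
      unfolding uv by blast
    then show ?thesis
      using True unfolding card[OF sub] card[OF assms(1)] edge_prob_def iff by simp
  next
    case False
    have "real (card (compatible_colorings V q (insert e A))) * real q =
        real (card (compatible_colorings V q A))"
      using card_compatible_colorings_insert[OF assms(1) _ False] assms(2)
      unfolding uv of_nat_mult[symmetric] by simp
    then show ?thesis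
      using False q_pos unfolding card[OF sub] card[OF assms(1)] edge_prob_def iff
      by (simp add: field_simps)
  qed
qed

section \<open>The single-bond chain is reversible and irreducible\<close>

lemma rc_weight_pos: "0 < rc_weight A"
  using odds_pos q_pos by (simp add: rc_weight_def)

lemma P_edge_detailed_balance:
  assumes "A \<subseteq> E" "B \<subseteq> E" "e \<in> E"
  shows "rc_weight A * P_edge p q e A B = rc_weight B * P_edge p q e B A"
proof -
  have insert: "rc_weight A * P_edge p q e A (insert e A) = rc_weight (insert e A) * P_edge p q e (insert e A) A"
    if "A \<subseteq> E" "e \<notin> A" for A
  proof -
    obtain u v where uv: "e = {u, v}" using assms(3) by (rule edgeE)
    have "(u, v) \<in> conn (insert e A)" by (rule conn_edge) (simp add: uv)
    then have "edge_prob p q e (insert e A) = p" unfolding edge_prob_def uv by auto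
    then have "P_edge p q e (insert e A) A = 1 - p"
      using P_edge_remove[of p q e "insert e A"] that(2) by simp
    moreover have "rc_weight (insert e A) * (1 - p) =
        odds ^ card A * ((odds * (1 - p)) * real q ^ ncomp V (insert e A))"
      using that finite_edge_subset by (simp add: rc_weight_def)
    moreover have "odds * (1 - p) = p" using p_less_1 by (simp add: odds_def)
    ultimately have "rc_weight (insert e A) * P_edge p q e (insert e A) A =
        odds ^ card A * (p * real q ^ ncomp V (insert e A))" by metis
    then show ?thesis
      unfolding P_edge_insert edge_prob_ncomp[OF that(1) assms(3), symmetric]
      by (simp add: rc_weight_def)
  qed
  consider "\<not> sym_diff A B \<subseteq> {e}" | "A = B" | "e \<notin> A" "B = insert e A" | "e \<notin> B" "A = insert e B"
    by blast
  then show ?thesis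
  proof cases
    case 1
    then have "\<not> sym_diff B A \<subseteq> {e}" by blast
    then show ?thesis using 1 by (simp add: P_edge_eq_0)
  qed (use insert assms in auto)
qed

lemma P_edge_row_sum:
  assumes "A \<subseteq> E" "e \<in> E"
  shows "(\<Sum>B\<in>Pow E. P_edge p q e A B) = 1"
  using kernel_op_P_edge[OF finite_E assms, of p q "\<lambda>_. 1"] by (simp add: kernel_op_def)

lemma edge_prob_bounds: "0 < edge_prob p q e A" "edge_prob p q e A < 1"
proof -
  have "p / real q \<le> p" using p_pos q_pos by (simp add: divide_le_eq)
  moreover have "0 < p / real q" using p_pos q_pos by simp
  ultimately show "0 < edge_prob p q e A" "edge_prob p q e A < 1"
    using p_pos p_less_1 unfolding edge_prob_def by auto
qed

lemma P_edge_nonneg: "0 \<le> P_edge p q e A B"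
proof -
  have "p / real q \<le> p" "0 < p / real q" using p_pos q_pos by (simp_all add: divide_le_eq)
  then show ?thesis using p_pos p_less_1 by (simp add: P_edge_def)
qed

lemma P_edge_flip_pos: "0 < P_edge p q e A (sym_diff A {e})"
proof (cases "e \<in> A")
  case True
  then have "sym_diff A {e} = A - {e}" by blast
  then show ?thesis using edge_prob_bounds by (simp add: P_edge_remove)
next
  case False
  then have "sym_diff A {e} = insert e A" by blast
  then show ?thesis using edge_prob_bounds by (simp add: P_edge_insert)
qed

lemma kernel_op_P_SB:
  assumes "A \<subseteq> E"
  shows "kernel_op (Pow E) (P_SB E p q) f A =
    1 / 2 * f A + 1 / (2 * real (card E)) * (\<Sum>e\<in>E. kernel_op (Pow E) (P_edge p q e) f A)"
proof -
  have "(\<Sum>B\<in>Pow E. of_bool (A = B) * f B) = f A"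
    using assms finite_E by (subst sum.remove[of _ A]) auto
  moreover have "(\<Sum>B\<in>Pow E. (\<Sum>e\<in>E. P_edge p q e A B) * f B) =
      (\<Sum>e\<in>E. kernel_op (Pow E) (P_edge p q e) f A)"
    unfolding kernel_op_def sum_distrib_right by (rule sum.swap)
  moreover have "kernel_op (Pow E) (P_SB E p q) f A =
      1 / 2 * (\<Sum>B\<in>Pow E. of_bool (A = B) * f B) +
      1 / (2 * real (card E)) * (\<Sum>B\<in>Pow E. (\<Sum>e\<in>E. P_edge p q e A B) * f B)"
    unfolding kernel_op_def sum_distrib_left[of _ _ "Pow E"] sum.distrib[symmetric]
    by (rule sum.cong[OF refl]) (simp add: P_SB_def ring_distribs)
  ultimately show ?thesis by simp
qed

lemma reversible_kernel_P_SB: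
  assumes "E \<noteq> {}"
  shows "reversible_kernel (Pow E) rc_weight (P_SB E p q)"
proof
  show "finite (Pow E)" using finite_E by simp
  show "0 < rc_weight A" for A by (rule rc_weight_pos)
  fix A assume A: "A \<in> Pow E"
  have "kernel_op (Pow E) (P_SB E p q) (\<lambda>_. 1) A =
      1 / 2 + 1 / (2 * real (card E)) * (\<Sum>e\<in>E. 1)"
    using A by (subst kernel_op_P_SB) (simp_all add: kernel_op_def P_edge_row_sum)
  also have "\<dots> = 1" using assms finite_E by simp
  finally show "(\<Sum>B\<in>Pow E. P_SB E p q A B) = 1" by (simp add: kernel_op_def)
  fix B assume B: "B \<in> Pow E"
  have "rc_weight A * (\<Sum>e\<in>E. P_edge p q e A B) = rc_weight B * (\<Sum>e\<in>E. P_edge p q e B A)"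
    unfolding sum_distrib_left
    using P_edge_detailed_balance A B by (intro sum.cong) auto
  then show "rc_weight A * P_SB E p q A B = rc_weight B * P_SB E p q B A"
    unfolding P_SB_def by (auto simp: ring_distribs mult.left_commute)
qed

lemma P_SB_nonneg: "0 \<le> P_SB E p q A B"
  unfolding P_SB_def by (simp add: sum_nonneg P_edge_nonneg)

lemma P_SB_flip_pos:
  assumes "e \<in> E"
  shows "0 < P_SB E p q A (sym_diff A {e})"
proof -
  have "0 < (\<Sum>e'\<in>E. P_edge p q e' A (sym_diff A {e}))"
    by (rule sum_pos2[OF finite_E assms P_edge_flip_pos P_edge_nonneg])
  moreover have "0 < card E" using assms finite_E card_gt_0_iff by blast
  ultimately show ?thesis by (simp add: P_SB_def add_nonneg_pos)
qed

lemma irreducible_P_SB: "irreducible_kernel (Pow E) (P_SB E p q)"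
  unfolding irreducible_kernel_def
proof (intro allI impI)
  fix T assume T: "T \<subseteq> Pow E" "T \<noteq> {}" and "\<forall>A\<in>T. \<forall>B\<in>Pow E. 0 < P_SB E p q A B \<longrightarrow> B \<in> T"
  then have flip: "sym_diff A {e} \<in> T" if "A \<in> T" "e \<in> E" for A e
    using P_SB_flip_pos[OF that(2), of A] that by blast
  obtain A where A: "A \<in> T" using T(2) by blast
  have flips: "D \<subseteq> E \<Longrightarrow> sym_diff A D \<in> T" if "finite D" for D
    using that
  proof (induction D)
    case empty
    then show ?case using A by simp
  next
    case (insert e D)
    have "sym_diff (sym_diff A D) {e} = sym_diff A (insert e D)" using insert.hyps by blast
    then show ?case using flip[of "sym_diff A D" e] insert by simp
  qed
  show "T = Pow E"
  proof
    show "Pow E \<subseteq> T"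
    proof
      fix B assume "B \<in> Pow E"
      then have "sym_diff A B \<subseteq> E" using A T(1) by blast
      moreover have "sym_diff A (sym_diff A B) = B" by blast
      ultimately show "B \<in> T" using flips[of "sym_diff A B"] finite_edge_subset by simp
    qed
  qed (rule T(1))
qed

section \<open>Conditioning on the coloring\<close>

lemma sum_compatible_swap:
  "(\<Sum>A\<in>Pow E. \<Sum>\<sigma>\<in>compatible_colorings V q A. F A \<sigma>) =
    (\<Sum>\<sigma>\<in>colorings V q. \<Sum>A\<in>Pow (mono_edges E \<sigma>). F A \<sigma>)"
proof -
  have "(\<Sum>A\<in>Pow E. \<Sum>\<sigma>\<in>compatible_colorings V q A. F A \<sigma>) =
      (\<Sum>A\<in>Pow E. \<Sum>\<sigma>\<in>{\<sigma> \<in> colorings V q. A \<subseteq> mono_edges E \<sigma>}. F A \<sigma>)"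
    by (intro sum.cong refl) (auto simp: compatible_colorings_iff)
  also have "\<dots> = (\<Sum>\<sigma>\<in>colorings V q. \<Sum>A\<in>{A \<in> Pow E. A \<subseteq> mono_edges E \<sigma>}. F A \<sigma>)"
    by (rule sum.swap_restrict) (simp_all add: finite_E finite_colorings)
  also have "\<dots> = (\<Sum>\<sigma>\<in>colorings V q. \<Sum>A\<in>Pow (mono_edges E \<sigma>). F A \<sigma>)"
    by (intro sum.cong refl) (use mono_edges_subset in auto)
  finally show ?thesis .
qed

lemma sum_compatible_const:
  "A \<subseteq> E \<Longrightarrow> (\<Sum>\<sigma>\<in>compatible_colorings V q A. c) = real q ^ ncomp V A * c"
  by (simp add: card_compatible_colorings)

text \<open>If \<open>g\<close> at \<open>A\<close> is the average over the compatible colorings \<open>\<sigma>\<close> of \<open>h \<sigma> A\<close>, then its pairing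
  with \<open>f\<close> is a sum over colorings of percolation averages.\<close>

lemma weighted_inner_eq_sum_colorings:
  assumes "\<And>A. A \<subseteq> E \<Longrightarrow>
    rc_weight A * g A = (\<Sum>\<sigma>\<in>compatible_colorings V q A. odds ^ card A * h \<sigma> A)"
  shows "weighted_inner (Pow E) rc_weight f g =
    (\<Sum>\<sigma>\<in>colorings V q. \<Sum>A\<in>Pow (mono_edges E \<sigma>). odds ^ card A * f A * h \<sigma> A)"
proof -
  have "weighted_inner (Pow E) rc_weight f g = (\<Sum>A\<in>Pow E. f A * (rc_weight A * g A))"
    by (simp add: weighted_inner_def mult_ac)
  also have "\<dots> = (\<Sum>A\<in>Pow E. \<Sum>\<sigma>\<in>compatible_colorings V q A. odds ^ card A * f A * h \<sigma> A)"
    by (intro sum.cong refl, subst assms) (auto simp: sum_distrib_left mult_ac)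
  also note sum_compatible_swap
  finally show ?thesis .
qed

text \<open>The averaging operator that resamples the edge \<open>e\<close> in percolation on the edge set \<open>S\<close>; it is
  the identity if \<open>e\<close> does not belong to \<open>S\<close>.\<close>

definition bond_update :: "'v set \<Rightarrow> 'v set set \<Rightarrow> ('v set set \<Rightarrow> real) \<Rightarrow> 'v set set \<Rightarrow> real" where
  "bond_update e S f A = (if e \<in> S then p * f (insert e A) + (1 - p) * f (A - {e}) else f A)"

text \<open>The update of \<open>e\<close> from \<open>A\<close> amounts to choosing a coloring compatible with \<open>A\<close> and then
  resampling \<open>e\<close> if it is monochromatic.\<close>

lemma rc_weight_P_edge:
  assumes "A \<subseteq> E" "e \<in> E"
  shows "rc_weight A * kernel_op (Pow E) (P_edge p q e) f A =
    (\<Sum>\<sigma>\<in>compatible_colorings V q A. odds ^ card A * bond_update e (mono_edges E \<sigma>) f A)"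
proof -
  let ?C = "compatible_colorings V q A" and ?D = "compatible_colorings V q (insert e A)"
  let ?a = "p * f (insert e A) + (1 - p) * f (A - {e})"
  have D: "?D = {\<sigma> \<in> ?C. e \<in> mono_edges E \<sigma>}" by (rule compatible_colorings_insert[OF assms])
  have DC: "?D \<subseteq> ?C" unfolding D by blast
  have sub: "insert e A \<subseteq> E" using assms by simp
  \<comment> \<open>colorings not constant on \<open>e\<close> are compatible with \<open>A\<close> only if \<open>e \<notin> A\<close>\<close>
  have off: "f A = f (A - {e})" if "\<sigma> \<in> ?C - ?D" for \<sigma>
  proof -
    have "e \<notin> A" using that assms(1) unfolding D by (auto simp: compatible_colorings_iff)
    then show ?thesis by simp
  qed
  have "(\<Sum>\<sigma>\<in>?C. bond_update e (mono_edges E \<sigma>) f A) = (\<Sum>\<sigma>\<in>?C - ?D. f (A - {e})) + (\<Sum>\<sigma>\<in>?D. ?a)"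
    unfolding sum.subset_diff[OF DC finite_compatible_colorings]
    by (intro arg_cong2[of _ _ _ _ "(+)"] sum.cong refl) (use off in \<open>auto simp: bond_update_def D\<close>)
  also have "(\<Sum>\<sigma>\<in>?C - ?D. f (A - {e})) = (\<Sum>\<sigma>\<in>?C. f (A - {e})) - (\<Sum>\<sigma>\<in>?D. f (A - {e}))"
    by (rule sum_diff[OF finite_compatible_colorings DC])
  also have "\<dots> + (\<Sum>\<sigma>\<in>?D. ?a) = real q ^ ncomp V A * f (A - {e}) +
      (p * real q ^ ncomp V (insert e A)) * (f (insert e A) - f (A - {e}))"
    unfolding sum_compatible_const[OF assms(1)] sum_compatible_const[OF sub]
    by (simp add: algebra_simps)
  also have "\<dots> = real q ^ ncomp V A * kernel_op (Pow E) (P_edge p q e) f A"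
    unfolding edge_prob_ncomp[OF assms, symmetric] kernel_op_P_edge[OF finite_E assms]
    by (simp add: algebra_simps)
  finally show ?thesis by (simp add: rc_weight_def sum_distrib_left[symmetric])
qed

text \<open>The analogue for the Swendsen--Wang step, where all monochromatic edges are resampled.\<close>

lemma rc_weight_P_SW:
  assumes "A \<subseteq> E"
  shows "rc_weight A * kernel_op (Pow E) (P_SW V E p q) f A =
    (\<Sum>\<sigma>\<in>compatible_colorings V q A. odds ^ card A * ((1 - p) ^ card (mono_edges E \<sigma>) *
      (\<Sum>B\<in>Pow (mono_edges E \<sigma>). odds ^ card B * f B)))"
proof -
  let ?C = "compatible_colorings V q A"
  let ?k = "\<lambda>\<sigma>. (1 - p) ^ card (mono_edges E \<sigma>)"
  have restrict: "(\<Sum>B\<in>Pow E. of_bool (B \<subseteq> mono_edges E \<sigma>) * (odds ^ card B * f B)) =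
      (\<Sum>B\<in>Pow (mono_edges E \<sigma>). odds ^ card B * f B)" for \<sigma>
    by (rule sum.mono_neutral_cong_right) (use finite_E mono_edges_subset in auto)
  have split: "(\<Sum>\<sigma>\<in>colorings V q. ?k \<sigma> * of_bool (\<sigma> \<in> compatible_colorings V q (A \<union> B))) =
      (\<Sum>\<sigma>\<in>?C. ?k \<sigma> * of_bool (B \<subseteq> mono_edges E \<sigma>))" if "B \<subseteq> E" for B
  proof (rule sum.mono_neutral_cong_right)
    show "finite (colorings V q)" by (rule finite_colorings)
    show "?C \<subseteq> colorings V q" by (auto simp: compatible_colorings_def)
  qed (use assms that in \<open>auto simp: compatible_colorings_iff\<close>)
  have "real q ^ ncomp V A * kernel_op (Pow E) (P_SW V E p q) f A =
      (\<Sum>B\<in>Pow E. \<Sum>\<sigma>\<in>?C. ?k \<sigma> * (of_bool (B \<subseteq> mono_edges E \<sigma>) * (odds ^ card B * f B)))"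
    unfolding kernel_op_def sum_distrib_left
  proof (intro sum.cong refl)
    fix B assume "B \<in> Pow E"
    then have "real q ^ ncomp V A * (P_SW V E p q A B * f B) =
        odds ^ card B * f B * (\<Sum>\<sigma>\<in>?C. ?k \<sigma> * of_bool (B \<subseteq> mono_edges E \<sigma>))"
      using q_pos unfolding P_SW_def by (subst split) (simp_all add: odds_def)
    then show "real q ^ ncomp V A * (P_SW V E p q A B * f B) =
        (\<Sum>\<sigma>\<in>?C. ?k \<sigma> * (of_bool (B \<subseteq> mono_edges E \<sigma>) * (odds ^ card B * f B)))"
      by (simp add: sum_distrib_left mult_ac)
  qed
  also have "\<dots> = (\<Sum>\<sigma>\<in>?C. ?k \<sigma> * (\<Sum>B\<in>Pow E. of_bool (B \<subseteq> mono_edges E \<sigma>) * (odds ^ card B * f B)))"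
    unfolding sum_distrib_left by (rule sum.swap)
  also have "\<dots> = (\<Sum>\<sigma>\<in>?C. ?k \<sigma> * (\<Sum>B\<in>Pow (mono_edges E \<sigma>). odds ^ card B * f B))"
    unfolding restrict ..
  finally show ?thesis by (simp add: rc_weight_def sum_distrib_left[symmetric])
qed

section \<open>Comparison of the quadratic forms\<close>

lemma sum_Pow_insert:
  assumes "finite S" "e \<notin> S"
  shows "(\<Sum>A\<in>Pow (insert e S). F A) = (\<Sum>A\<in>Pow S. F A + F (insert e A))"
proof -
  have "inj_on (insert e) (Pow S)" using assms(2) by (auto simp: inj_on_def)
  then have "(\<Sum>A\<in>insert e ` Pow S. F A) = (\<Sum>A\<in>Pow S. F (insert e A))"
    by (simp add: sum.reindex)
  moreover have "Pow S \<inter> insert e ` Pow S = {}" using assms(2) by auto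
  ultimately show ?thesis
    using assms(1) by (simp add: Pow_insert sum.union_disjoint sum.distrib)
qed

lemma sum_odds_Pow: "finite S \<Longrightarrow> (1 - p) ^ card S * (\<Sum>A\<in>Pow S. odds ^ card A) = 1"
proof (induction S rule: finite_induct)
  case (insert e S)
  have "(\<Sum>A\<in>Pow (insert e S). odds ^ card A) = (\<Sum>A\<in>Pow S. odds ^ card A * (1 + odds))"
    unfolding sum_Pow_insert[OF insert.hyps]
    using insert.hyps by (intro sum.cong refl) (auto simp: finite_subset card_insert_if algebra_simps)
  then show ?case
    using insert p_less_1 by (simp add: sum_divide_distrib[symmetric] one_plus_odds)
qed simp

text \<open>By \<open>sum_odds_Pow\<close>, the weights \<open>(1 - p) ^ card S * odds ^ card A\<close> form a probability distribution
  on the subsets of \<open>S\<close>; the inequality is Cauchy--Schwarz for it, multiplied by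
  \<open>(1 - p) ^ - card S\<close>.\<close>

lemma mean_square_le:
  assumes "finite S"
  shows "(1 - p) ^ card S * (\<Sum>A\<in>Pow S. odds ^ card A * f A)\<^sup>2 \<le> (\<Sum>A\<in>Pow S. odds ^ card A * (f A)\<^sup>2)"
proof -
  have "(\<Sum>A\<in>Pow S. sqrt (odds ^ card A) * (sqrt (odds ^ card A) * f A))\<^sup>2 \<le>
      (\<Sum>A\<in>Pow S. (sqrt (odds ^ card A))\<^sup>2) * (\<Sum>A\<in>Pow S. (sqrt (odds ^ card A) * f A)\<^sup>2)"
    by (rule Cauchy_Schwarz_ineq_sum)
  then have "(\<Sum>A\<in>Pow S. odds ^ card A * f A)\<^sup>2 \<le>
      (\<Sum>A\<in>Pow S. odds ^ card A) * (\<Sum>A\<in>Pow S. odds ^ card A * (f A)\<^sup>2)"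
    using odds_pos by (simp add: mult.assoc[symmetric] power_mult_distrib less_imp_le)
  then have "(1 - p) ^ card S * (\<Sum>A\<in>Pow S. odds ^ card A * f A)\<^sup>2 \<le>
      (1 - p) ^ card S * ((\<Sum>A\<in>Pow S. odds ^ card A) * (\<Sum>A\<in>Pow S. odds ^ card A * (f A)\<^sup>2))"
    using p_less_1 by (intro mult_left_mono) auto
  also have "\<dots> = (\<Sum>A\<in>Pow S. odds ^ card A * (f A)\<^sup>2)"
    unfolding mult.assoc[symmetric] sum_odds_Pow[OF assms] by simp
  finally show ?thesis .
qed

text \<open>If \<open>e \<in> S\<close>, both sides depend only on the average \<open>h\<close> of \<open>f\<close> over the state of \<open>e\<close>, and the
  claim is the preceding inequality for \<open>h\<close> on \<open>S - {e}\<close>.\<close>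

lemma mean_square_le_bond_update:
  assumes "finite S"
  shows "(1 - p) ^ card S * (\<Sum>A\<in>Pow S. odds ^ card A * f A)\<^sup>2 \<le>
    (\<Sum>A\<in>Pow S. odds ^ card A * f A * bond_update e S f A)"
proof (cases "e \<in> S")
  case False
  then show ?thesis
    using mean_square_le[OF assms, of f] by (simp add: bond_update_def power2_eq_square mult.assoc)
next
  case True
  define S' where "S' = S - {e}"
  have S': "finite S'" "e \<notin> S'" "S = insert e S'" using True assms by (auto simp: S'_def)
  define h where "h A = p * f (insert e A) + (1 - p) * f A" for A
  have card: "card (insert e A) = Suc (card A)" if "A \<in> Pow S'" for A
  proof -
    have "finite A" "e \<notin> A" using that S' finite_subset[of A S'] by auto
    then show ?thesis by simp
  qed
  have off: "A - {e} = A" if "A \<in> Pow S'" for A using that S' by blast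
  have h: "f A + odds * f (insert e A) = h A / (1 - p)" for A
    using p_less_1 by (simp add: h_def odds_def field_simps)
  have 1: "(\<Sum>A\<in>Pow S. odds ^ card A * f A) = (\<Sum>A\<in>Pow S'. odds ^ card A * h A) / (1 - p)"
  proof -
    have "(\<Sum>A\<in>Pow S. odds ^ card A * f A) =
        (\<Sum>A\<in>Pow S'. odds ^ card A * (f A + odds * f (insert e A)))"
      unfolding S'(3) sum_Pow_insert[OF S'(1,2)]
      by (intro sum.cong refl) (simp add: card algebra_simps)
    then show ?thesis by (simp add: h sum_divide_distrib)
  qed
  have 2: "(\<Sum>A\<in>Pow S. odds ^ card A * f A * bond_update e S f A) =
      (\<Sum>A\<in>Pow S'. odds ^ card A * (h A)\<^sup>2) / (1 - p)"
  proof -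
    have "(\<Sum>A\<in>Pow S. odds ^ card A * f A * bond_update e S f A) =
        (\<Sum>A\<in>Pow S'. odds ^ card A * (f A + odds * f (insert e A)) * h A)"
      unfolding S'(3) sum_Pow_insert[OF S'(1,2)]
    proof (intro sum.cong refl)
      fix A assume A: "A \<in> Pow S'"
      then have "insert e A - {e} = A" using S'(2) by blast
      then show "odds ^ card A * f A * bond_update e (insert e S') f A +
          odds ^ card (insert e A) * f (insert e A) * bond_update e (insert e S') f (insert e A) =
          odds ^ card A * (f A + odds * f (insert e A)) * h A"
        by (simp add: bond_update_def h_def card[OF A] off[OF A] algebra_simps)
    qed
    then show ?thesis by (simp add: h sum_divide_distrib power2_eq_square mult.assoc)
  qed
  have "(1 - p) ^ card S * (\<Sum>A\<in>Pow S. odds ^ card A * f A)\<^sup>2 =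
      (1 - p) ^ card S' * (\<Sum>A\<in>Pow S'. odds ^ card A * h A)\<^sup>2 / (1 - p)"
    using S' p_less_1 unfolding 1 by (simp add: power_divide power2_eq_square)
  also have "\<dots> \<le> (\<Sum>A\<in>Pow S'. odds ^ card A * (h A)\<^sup>2) / (1 - p)"
    using mean_square_le[OF S'(1), of h] p_less_1 by (intro divide_right_mono) auto
  finally show ?thesis unfolding 2 .
qed

lemma form_P_SW:
  "weighted_inner (Pow E) rc_weight f (kernel_op (Pow E) (P_SW V E p q) f) =
    (\<Sum>\<sigma>\<in>colorings V q. (1 - p) ^ card (mono_edges E \<sigma>) *
      (\<Sum>A\<in>Pow (mono_edges E \<sigma>). odds ^ card A * f A)\<^sup>2)"
proof -
  have "weighted_inner (Pow E) rc_weight f (kernel_op (Pow E) (P_SW V E p q) f) =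
      (\<Sum>\<sigma>\<in>colorings V q. \<Sum>A\<in>Pow (mono_edges E \<sigma>). odds ^ card A * f A *
        ((1 - p) ^ card (mono_edges E \<sigma>) * (\<Sum>B\<in>Pow (mono_edges E \<sigma>). odds ^ card B * f B)))"
    by (rule weighted_inner_eq_sum_colorings) (rule rc_weight_P_SW)
  then show ?thesis
    unfolding sum_distrib_right[symmetric] by (simp add: power2_eq_square mult_ac)
qed

lemma form_P_edge:
  assumes "e \<in> E"
  shows "weighted_inner (Pow E) rc_weight f (kernel_op (Pow E) (P_edge p q e) f) =
    (\<Sum>\<sigma>\<in>colorings V q. \<Sum>A\<in>Pow (mono_edges E \<sigma>).
      odds ^ card A * f A * bond_update e (mono_edges E \<sigma>) f A)"
  by (rule weighted_inner_eq_sum_colorings) (rule rc_weight_P_edge[OF _ assms])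

lemma form_P_SW_le_form_P_edge:
  assumes "e \<in> E"
  shows "weighted_inner (Pow E) rc_weight f (kernel_op (Pow E) (P_SW V E p q) f) \<le>
    weighted_inner (Pow E) rc_weight f (kernel_op (Pow E) (P_edge p q e) f)"
  unfolding form_P_SW form_P_edge[OF assms]
  by (intro sum_mono mean_square_le_bond_update finite_mono_edges)

lemma form_P_SW_le_norm:
  "weighted_inner (Pow E) rc_weight f (kernel_op (Pow E) (P_SW V E p q) f) \<le>
    weighted_inner (Pow E) rc_weight f f"
proof -
  have "weighted_inner (Pow E) rc_weight f f =
      (\<Sum>\<sigma>\<in>colorings V q. \<Sum>A\<in>Pow (mono_edges E \<sigma>). odds ^ card A * f A * f A)"
    by (rule weighted_inner_eq_sum_colorings)
      (simp add: card_compatible_colorings rc_weight_def)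
  then show ?thesis
    unfolding form_P_SW using mean_square_le[OF finite_mono_edges, of _ f]
    by (simp add: sum_mono power2_eq_square mult.assoc)
qed

text \<open>The form of \<open>P_SB\<close> is a convex combination of the squared norm and the forms of the single
  edges, each of which dominates the form of \<open>P_SW\<close>.\<close>

lemma form_P_SW_le_form_P_SB:
  assumes "E \<noteq> {}"
  shows "weighted_inner (Pow E) rc_weight f (kernel_op (Pow E) (P_SW V E p q) f) \<le>
    weighted_inner (Pow E) rc_weight f (kernel_op (Pow E) (P_SB E p q) f)" (is "?SW \<le> ?SB")
proof -
  let ?ip = "weighted_inner (Pow E) rc_weight"
  have m: "0 < real (card E)" using assms finite_E by (simp add: card_gt_0_iff)
  have "?SB = 1 / 2 * ?ip f f +
      1 / (2 * real (card E)) * (\<Sum>e\<in>E. ?ip f (kernel_op (Pow E) (P_edge p q e) f))"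
  proof -
    have "?SB = (\<Sum>A\<in>Pow E. 1 / 2 * (rc_weight A * f A * f A) + 1 / (2 * real (card E)) *
        (\<Sum>e\<in>E. rc_weight A * f A * kernel_op (Pow E) (P_edge p q e) f A))"
      unfolding weighted_inner_def
      by (intro sum.cong refl) (simp add: kernel_op_P_SB ring_distribs sum_distrib_left[symmetric] mult_ac)
    also have "\<dots> = 1 / 2 * ?ip f f + 1 / (2 * real (card E)) *
        (\<Sum>A\<in>Pow E. \<Sum>e\<in>E. rc_weight A * f A * kernel_op (Pow E) (P_edge p q e) f A)"
      unfolding weighted_inner_def sum.distrib sum_distrib_left[symmetric] ..
    finally show ?thesis unfolding weighted_inner_def by (subst sum.swap)
  qed
  moreover have "real (card E) * ?SW \<le> (\<Sum>e\<in>E. ?ip f (kernel_op (Pow E) (P_edge p q e) f))"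
  proof -
    have "(\<Sum>e\<in>E. ?SW) \<le> (\<Sum>e\<in>E. ?ip f (kernel_op (Pow E) (P_edge p q e) f))"
      by (rule sum_mono) (rule form_P_SW_le_form_P_edge)
    then show ?thesis by simp
  qed
  then have "1 / (2 * real (card E)) * (real (card E) * ?SW) \<le>
      1 / (2 * real (card E)) * (\<Sum>e\<in>E. ?ip f (kernel_op (Pow E) (P_edge p q e) f))"
    by (intro mult_left_mono) auto
  ultimately show ?thesis using form_P_SW_le_norm[of f] m by simp
qed

lemma form_P_SW_nonneg:
  "0 \<le> weighted_inner (Pow E) rc_weight f (kernel_op (Pow E) (P_SW V E p q) f)"
  unfolding form_P_SW using p_less_1 by (intro sum_nonneg) simp

lemma reversible_kernel_P_SW: "reversible_kernel (Pow E) rc_weight (P_SW V E p q)"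
proof
  show "finite (Pow E)" using finite_E by simp
  show "0 < rc_weight A" for A by (rule rc_weight_pos)
  fix A assume "A \<in> Pow E"
  then have A: "A \<subseteq> E" by simp
  have "rc_weight A * kernel_op (Pow E) (P_SW V E p q) (\<lambda>_. 1) A = rc_weight A"
    unfolding rc_weight_P_SW[OF A]
    by (simp add: sum_odds_Pow finite_mono_edges sum_compatible_const[OF A] rc_weight_def
        card_compatible_colorings[OF A])
  then show "(\<Sum>B\<in>Pow E. P_SW V E p q A B) = 1"
    using rc_weight_pos[of A] by (simp add: kernel_op_def)
  have "rc_weight A * P_SW V E p q A B = odds ^ card A * odds ^ card B *
      (\<Sum>\<sigma>\<in>colorings V q. (1 - p) ^ card (mono_edges E \<sigma>) *
        of_bool (\<sigma> \<in> compatible_colorings V q (A \<union> B)))" for A B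
    using q_pos by (simp add: rc_weight_def P_SW_def odds_def)
  then show "rc_weight A * P_SW V E p q A B = rc_weight B * P_SW V E p q B A" for B
    by (simp add: Un_commute mult.commute)
qed

lemma spectral_gap_P_SB_le_P_SW:
  assumes "E \<noteq> {}"
  shows "spectral_gap (Pow E) (P_SB E p q) \<le> spectral_gap (Pow E) (P_SW V E p q)"
proof (rule spectral_gap_mono_form[OF reversible_kernel_P_SW reversible_kernel_P_SB[OF assms]])
  have "1 \<le> card E" using assms finite_E by (simp add: Suc_leI card_gt_0_iff)
  then have "(2::nat) ^ 1 \<le> 2 ^ card E" by (intro power_increasing) auto
  then show "2 \<le> card (Pow E)" by (simp add: card_Pow finite_E)
qed (rule irreducible_P_SB form_P_SW_nonneg form_P_SW_le_form_P_SB[OF assms] P_SB_nonneg)+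

end

theorem theorem5:
  fixes V :: "'v set" and E :: "'v set set" and p :: real and q :: nat
  assumes "finite_graph V E"
    and "E \<noteq> {}"
    and "0 < p" and "p < 1"
    and "1 \<le> q"
  shows "spectral_gap (Pow E) (P_SW V E p q) \<ge> spectral_gap (Pow E) (P_SB E p q)"
proof -
  interpret random_cluster V E p q
    using assms by unfold_locales
  show ?thesis by (rule spectral_gap_P_SB_le_P_SW[OF assms(2)])
qed

end
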